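(* Let $G$ be a (Hausdorff, hence Tychonoff) feathered topological group. Then $G$ is a $\kappa$-Fréchet--Urysohn space.
   Context: All topological spaces are assumed to be Tychonoff. A topological group $G$ is called feathered if it contains a nonempty compact set $K$ of countable character in $G$, i.e. there is a countable family $\{U_n\}_{n\in\omega}$ of open subsets of $G$ containing $K$ such that every open set containing $K$ contains some $U_n$. A space $X$ is called $\kappa$-Fréchet--Urysohn if for every open subset $U$ of $X$ and every $x\in\overline{U}$ there exists a sequence $\{x_n\}_{n\in\omega}\subseteq U$ converging to $x$. *)

theory Defs
  imports "HOL-Analysis.Analysis"
begin

definition countable_character_in :: "'a topology \<Rightarrow> 'a set \<Rightarrow> bool" where
  "countable_character_in X K \<longleftrightarrow>
     (\<exists>U :: nat \<Rightarrow> 'a set.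
        (\<forall>n. openin X (U n) \<and> K \<subseteq> U n) \<and>
        (\<forall>V. openin X V \<and> K \<subseteq> V \<longrightarrow> (\<exists>n. U n \<subseteq> V)))"

text \<open>Being feathered depends only on the underlying space of a topological group, so it is
  defined as a property of that space.\<close>

definition feathered :: "'a topology \<Rightarrow> bool" where
  "feathered X \<longleftrightarrow> (\<exists>K. K \<noteq> {} \<and> compactin X K \<and> countable_character_in X K)"

definition kappa_Frechet_Urysohn :: "'a topology \<Rightarrow> bool" where
  "kappa_Frechet_Urysohn X \<longleftrightarrow>
     (\<forall>U x. openin X U \<and> x \<in> X closure_of U \<longrightarrow>
        (\<exists>s :: nat \<Rightarrow> 'a. range s \<subseteq> U \<and> limitin X s x sequentially))"

end

theory Submission
  imports Defs
begin

text \<open>By translation it suffices to approach \<open>0 \<in> closure U\<close>. Choose symmetric neighbourhoods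
  \<open>V\<^sub>n\<close> of \<open>0\<close> and points \<open>x\<^sub>n \<in> U \<inter> V\<^sub>n\<close> with \<open>V\<^sub>n\<^sub>+\<^sub>1 + V\<^sub>n\<^sub>+\<^sub>1 \<subseteq> V\<^sub>n\<close> and
  \<open>x\<^sub>n + V\<^sub>n\<^sub>+\<^sub>1 \<subseteq> U\<close>, taking \<open>V\<^sub>n\<close> inside the \<open>n\<close>-th neighbourhood of the compact set of countable
  character. Then \<open>H = \<Inter>V\<^sub>n\<close> is a compact subgroup with neighbourhood base \<open>V\<^sub>n\<close>, and the cosets
  \<open>x\<^sub>n + H\<close> lie in \<open>U\<close> and converge to \<open>H\<close>. It remains to pick points of these cosets that
  converge to \<open>0\<close>. By Zorn's lemma, shrink \<open>H\<close> and the cosets to a minimal subgroup \<open>M\<close> with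
  cosets converging to \<open>M\<close>: compactness handles chains, and a nontrivial \<open>M\<close> can be shrunk further
  because it is cut properly by a subgroup \<open>\<Inter>V\<^sub>n\<close> of the above kind, relative to which only
  countably many neighbourhoods have to be met. So \<open>M = {0}\<close>. The group is written additively
  but is not assumed to be commutative.\<close>

section \<open>Chains of compact sets\<close>

text \<open>If every \<open>f i\<close> left \<open>W\<close>, the compact set
  \<open>f i0 - W\<close> and the closed sets \<open>f i\<close> would have the finite intersection
  property, since finite subfamilies of a chain have a least member. The case \<open>W = {}\<close>
  gives nonempty intersections.\<close>

lemma compact_chain_subset_open:
  fixes f :: "'i \<Rightarrow> 'a::t2_space set"
  assumes "I \<noteq> {}"
    and cpt: "\<And>i. i \<in> I \<Longrightarrow> compact (f i)"
    and chain: "\<And>i j. i \<in> I \<Longrightarrow> j \<in> I \<Longrightarrow> f i \<subseteq> f j \<or> f j \<subseteq> f i"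
    and "open W" and sub: "(\<Inter>i\<in>I. f i) \<subseteq> W"
  shows "\<exists>i\<in>I. f i \<subseteq> W"
proof (rule ccontr)
  assume neg: "\<not> (\<exists>i\<in>I. f i \<subseteq> W)"
  obtain i0 where i0: "i0 \<in> I"
    using \<open>I \<noteq> {}\<close> by blast
  have least: "\<exists>j\<in>J. \<forall>i\<in>J. f j \<subseteq> f i" if "finite J" "J \<noteq> {}" "J \<subseteq> I" for J
    using that
  proof (induction J rule: finite_ne_induct)
    case (singleton i)
    then show ?case by simp
  next
    case (insert i J)
    then obtain j where j: "j \<in> J" "\<forall>k\<in>J. f j \<subseteq> f k" by auto
    have "f i \<subseteq> f j \<or> f j \<subseteq> f i"
      using chain insert.prems j(1) by auto
    with j show ?case by (metis insert_iff order_refl order_trans)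
  qed
  have "(f i0 - W) \<inter> (\<Inter>i\<in>I. f i) \<noteq> {}"
  proof (rule compact_imp_fip_image)
    show "compact (f i0 - W)"
      using cpt[OF i0] \<open>open W\<close> by (rule compact_diff)
    show "closed (f i)" if "i \<in> I" for i
      using cpt[OF that] by (rule compact_imp_closed)
    fix J assume "finite J" "J \<subseteq> I"
    \<comment> \<open>Inserting \<open>i0\<close> covers the case of empty \<open>J\<close> and
      places the least member inside \<open>f i0\<close>.\<close>
    then obtain j where j: "j \<in> insert i0 J" "\<forall>i\<in>insert i0 J. f j \<subseteq> f i"
      using least[of "insert i0 J"] i0 by auto
    then have "j \<in> I"
      using i0 \<open>J \<subseteq> I\<close> by blast
    with neg obtain x where "x \<in> f j" "x \<notin> W" by blast
    with j(2) have "x \<in> (f i0 - W) \<inter> (\<Inter>i\<in>J. f i)" by auto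
    then show "(f i0 - W) \<inter> (\<Inter>i\<in>J. f i) \<noteq> {}" by blast
  qed
  with sub show False by auto
qed

lemma closure_meets_open: "x \<in> closure S \<Longrightarrow> open T \<Longrightarrow> x \<in> T \<Longrightarrow> \<exists>z. z \<in> S \<and> z \<in> T"
  using open_Int_closure_eq_empty[of T S] by blast

section \<open>Subgroups and left cosets\<close>

definition add_subgroup :: "'a::group_add set \<Rightarrow> bool" where
  "add_subgroup M \<longleftrightarrow> 0 \<in> M \<and> (\<forall>x\<in>M. \<forall>y\<in>M. x + y \<in> M) \<and> (\<forall>x\<in>M. - x \<in> M)"

lemma add_subgroup_Inter: "(\<And>M. M \<in> \<M> \<Longrightarrow> add_subgroup M) \<Longrightarrow> add_subgroup (\<Inter>\<M>)"
  unfolding add_subgroup_def by blast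

lemma add_subgroup_Int: "add_subgroup M \<Longrightarrow> add_subgroup N \<Longrightarrow> add_subgroup (M \<inter> N)"
  unfolding add_subgroup_def by blast

lemma coset_eq:
  assumes "add_subgroup M" "a \<in> (+) c ` M"
  shows "(+) a ` M = (+) c ` M"
proof -
  obtain m where m: "m \<in> M" "a = c + m"
    using assms(2) by auto
  have "c + m + h \<in> (+) c ` M" if "h \<in> M" for h
    using assms(1) m(1) that by (auto simp: add_subgroup_def add.assoc)
  moreover have "c + h \<in> (+) a ` M" if "h \<in> M" for h
    by (rule image_eqI[of _ _ "- m + h"])
      (use assms(1) m that in \<open>auto simp: add_subgroup_def add.assoc\<close>)
  ultimately show ?thesis
    using m by auto
qed

lemma coset_self: "add_subgroup M \<Longrightarrow> c \<in> (+) c ` M"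
  by (force simp: add_subgroup_def)

section \<open>Translations and inversion\<close>

lemma continuous_on_add_left: "continuous_on A ((+) (c::'a::topological_group_add))"
  by (intro continuous_intros)

lemma compact_coset: "compact M \<Longrightarrow> compact ((+) (c::'a::topological_group_add) ` M)"
  by (rule compact_continuous_image[OF continuous_on_add_left])

lemma open_vimage_add_left: "open U \<Longrightarrow> open {z. (c::'a::topological_group_add) + z \<in> U}"
  using open_vimage[OF _ continuous_on_add_left] by (simp add: vimage_def)

lemma open_vimage_diff_right:
  fixes c :: "'a::topological_group_add"
  assumes "open U" shows "open {z. z - c \<in> U}"
proof -
  have "continuous_on UNIV (\<lambda>z::'a. z + - c)"
    by (intro continuous_intros)
  from open_vimage[OF assms this] show ?thesis
    by (simp add: vimage_def)
qed

lemma open_vimage_uminus: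
  fixes U :: "'a::topological_group_add set"
  assumes U: "open U" shows "open {z. - z \<in> U}"
proof -
  have "continuous_on UNIV (\<lambda>z::'a. - z)"
    unfolding continuous_on_def by (auto intro: tendsto_intros)
  from open_vimage[OF U this] show ?thesis
    by (simp add: vimage_def)
qed

section \<open>Towers of neighbourhoods of zero\<close>

lemma symmetric_nhd_halving:
  assumes "open (W :: 'a::topological_group_add set)" "0 \<in> W"
  obtains V where "open V" "0 \<in> V" "V \<subseteq> W" "\<And>x. x \<in> V \<Longrightarrow> - x \<in> V"
    "\<And>x y. x \<in> V \<Longrightarrow> y \<in> V \<Longrightarrow> x + y \<in> W"
proof -
  have "((\<lambda>p::'a\<times>'a. fst p + snd p) \<longlongrightarrow> 0 + 0) (nhds 0 \<times>\<^sub>F nhds 0)"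
    by (rule tendsto_add_Pair[unfolded case_prod_beta])
  then have "\<forall>\<^sub>F p in nhds 0 \<times>\<^sub>F nhds (0::'a). fst p + snd p \<in> W"
    by (rule topological_tendstoD) (use assms in simp_all)
  then obtain P Q where PQ: "eventually P (nhds 0)" "eventually Q (nhds (0::'a))"
    "\<forall>x y. P x \<longrightarrow> Q y \<longrightarrow> fst (x, y) + snd (x, y) \<in> W"
    unfolding eventually_prod_filter by blast
  obtain A where A: "open A" "0 \<in> A" "\<forall>x\<in>A. P x"
    using PQ(1) unfolding eventually_nhds by blast
  obtain B where B: "open B" "0 \<in> B" "\<forall>x\<in>B. Q x"
    using PQ(2) unfolding eventually_nhds by blast
  \<comment> \<open>\<open>A\<close> and \<open>B\<close> come from continuity of addition at
    \<open>(0, 0)\<close>. Intersecting \<open>C\<close> with its set of negatives below makes it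
    symmetric.\<close>
  define C where "C = A \<inter> B \<inter> W"
  have C: "open C" "0 \<in> C" "C \<subseteq> W"
    using A B assms by (auto simp: C_def)
  show thesis
  proof (rule that[of "C \<inter> {z. - z \<in> C}"])
    show "open (C \<inter> {z. - z \<in> C})"
      by (intro open_Int open_vimage_uminus C)
    show "x + y \<in> W" if "x \<in> C \<inter> {z. - z \<in> C}" "y \<in> C \<inter> {z. - z \<in> C}" for x y
      using that A(3) B(3) PQ(3) by (simp add: C_def)
  qed (use C in auto)
qed

text \<open>A countable system of neighbourhoods of zero, halved at each step so that its
  intersection is a closed subgroup. The sets decrease because each contains
  \<open>0\<close>.\<close>

definition nhd_tower :: "(nat \<Rightarrow> 'a::{group_add, topological_space} set) \<Rightarrow> bool" where
  "nhd_tower V \<longleftrightarrow> (\<forall>n. open (V n) \<and> 0 \<in> V n \<and> (\<forall>x\<in>V n. - x \<in> V n) \<and>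
     (\<forall>x\<in>V (Suc n). \<forall>y\<in>V (Suc n). x + y \<in> V n))"

lemma
  assumes "nhd_tower V"
  shows nhd_tower_open: "open (V n)"
    and nhd_tower_zero: "0 \<in> V n"
    and nhd_tower_uminus: "x \<in> V n \<Longrightarrow> - x \<in> V n"
    and nhd_tower_add: "x \<in> V (Suc n) \<Longrightarrow> y \<in> V (Suc n) \<Longrightarrow> x + y \<in> V n"
  using assms by (simp_all add: nhd_tower_def)

lemma nhd_tower_antimono:
  assumes "nhd_tower V" "m \<le> n" shows "V n \<subseteq> V m"
proof -
  have "V (Suc n) \<subseteq> V n" for n
  proof
    fix x assume "x \<in> V (Suc n)"
    from nhd_tower_add[OF assms(1) this nhd_tower_zero[OF assms(1)]] show "x \<in> V n"
      by simp
  qed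
  then show ?thesis
    using assms(2) by (rule lift_Suc_antimono_le)
qed

text \<open>A point \<open>y\<close> of the closure has some \<open>z\<close> in
  \<open>V (Suc n)\<close> with \<open>- y + z\<close> in \<open>V (Suc n)\<close>, and
  \<open>y = z - (- y + z)\<close>. Hence the intersection of the tower equals that of the closures
  and is closed.\<close>

lemma nhd_tower_closure:
  fixes V :: "nat \<Rightarrow> 'a::topological_group_add set"
  assumes "nhd_tower V" shows "closure (V (Suc n)) \<subseteq> V n"
proof
  fix y assume y: "y \<in> closure (V (Suc n))"
  have "open {z. - y + z \<in> V (Suc n)}"
    by (rule open_vimage_add_left[OF nhd_tower_open[OF assms]])
  moreover have "y \<in> {z. - y + z \<in> V (Suc n)}"
    using nhd_tower_zero[OF assms] by simp
  ultimately obtain z where z: "z \<in> V (Suc n)" "- y + z \<in> V (Suc n)"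
    using closure_meets_open[OF y] by blast
  then have "z + - (- y + z) \<in> V n"
    by (intro nhd_tower_add[OF assms] nhd_tower_uminus[OF assms] z)
  then show "y \<in> V n"
    by (simp add: minus_add add.assoc[symmetric])
qed

lemma nhd_tower_Inter_closure:
  fixes V :: "nat \<Rightarrow> 'a::topological_group_add set"
  assumes "nhd_tower V" shows "(\<Inter>n. closure (V n)) = (\<Inter>n. V n)"
proof
  show "(\<Inter>n. closure (V n)) \<subseteq> (\<Inter>n. V n)"
    using nhd_tower_closure[OF assms] by (intro INT_greatest) (rule order_trans[OF INF_lower], auto)
  show "(\<Inter>n. V n) \<subseteq> (\<Inter>n. closure (V n))"
    by (intro INF_mono') (rule closure_subset)
qed

lemma nhd_tower_closed_Inter:
  fixes V :: "nat \<Rightarrow> 'a::topological_group_add set"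
  assumes "nhd_tower V" shows "closed (\<Inter>n. V n)"
proof -
  have "closed (\<Inter>n. closure (V n))"
    by (intro closed_INT ballI closed_closure)
  then show ?thesis
    by (simp only: nhd_tower_Inter_closure[OF assms])
qed

lemma nhd_tower_subgroup:
  assumes "nhd_tower V" shows "add_subgroup (\<Inter>n. V n)"
  unfolding add_subgroup_def
proof (intro conjI ballI)
  show "0 \<in> (\<Inter>n. V n)"
    using assms by (simp add: nhd_tower_def)
  show "x + y \<in> (\<Inter>n. V n)" if "x \<in> (\<Inter>n. V n)" "y \<in> (\<Inter>n. V n)" for x y
    using assms that by (simp add: nhd_tower_def)
  show "- x \<in> (\<Inter>n. V n)" if "x \<in> (\<Inter>n. V n)" for x
    using assms that by (simp add: nhd_tower_def)
qed

text \<open>Iterated halving. With \<open>W\<close> the complement of a nonzero point, the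
  intersection is a closed subgroup omitting that point.\<close>

lemma nhd_tower_exists:
  assumes "open (W :: 'a::topological_group_add set)" "0 \<in> W"
  obtains V where "nhd_tower V" "V 0 \<subseteq> W"
proof -
  define P where "P V \<longleftrightarrow> open V \<and> 0 \<in> V \<and> V \<subseteq> W \<and> (\<forall>x\<in>V. - x \<in> V)" for V
  have halve: "\<exists>V. P V \<and> (\<forall>x\<in>V. \<forall>y\<in>V. x + y \<in> V')" if V': "open V'" "0 \<in> V'" "V' \<subseteq> W" for V'
  proof -
    obtain V where "open V" "0 \<in> V" "V \<subseteq> V'" "\<And>x. x \<in> V \<Longrightarrow> - x \<in> V"
      "\<And>x y. x \<in> V \<Longrightarrow> y \<in> V \<Longrightarrow> x + y \<in> V'"
      using symmetric_nhd_halving[OF V'(1,2)] by blast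
    with V'(3) show ?thesis
      unfolding P_def by (intro exI[of _ V]) auto
  qed
  have "\<exists>V. \<forall>n::nat. P (V n) \<and> (\<forall>x\<in>V (Suc n). \<forall>y\<in>V (Suc n). x + y \<in> V n)"
  proof (rule dependent_nat_choice)
    show "\<exists>V. P V"
      using halve[of W] assms by auto
    show "\<exists>V. P V \<and> (\<forall>x\<in>V. \<forall>y\<in>V. x + y \<in> V')" if "P V'" for V' and n :: nat
      using halve[of V'] that by (simp add: P_def)
  qed
  then obtain V where V: "P (V n)" "\<forall>x\<in>V (Suc n). \<forall>y\<in>V (Suc n). x + y \<in> V n" for n :: nat
    by blast
  show thesis
  proof (rule that[of V])
    show "nhd_tower V"
      using V by (simp add: nhd_tower_def P_def)
    show "V 0 \<subseteq> W"
      using V(1) by (simp add: P_def)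
  qed
qed

text \<open>Lying in \<open>W\<close> is split into being close to \<open>M\<close> and lying in one
  \<open>V i\<close>. The compact sets \<open>M \<inter> closure (V i)\<close> form a chain, so one
  of them is inside \<open>W\<close>; then \<open>W \<union> - closure (V i)\<close> serves as
  \<open>Q\<close>.\<close>

lemma nhd_tower_trap:
  fixes V :: "nat \<Rightarrow> 'a::{topological_group_add, t2_space} set"
  assumes V: "nhd_tower V" and M: "compact M" and W: "open W" "M \<inter> (\<Inter>n. V n) \<subseteq> W"
  obtains Q i where "open Q" "M \<subseteq> Q" "Q \<inter> V i \<subseteq> W"
proof -
  have "\<exists>i\<in>UNIV. M \<inter> closure (V i) \<subseteq> W"
  proof (rule compact_chain_subset_open)
    show "compact (M \<inter> closure (V i))" for i
      by (intro compact_Int_closed M closed_closure)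
    show "M \<inter> closure (V i) \<subseteq> M \<inter> closure (V j) \<or> M \<inter> closure (V j) \<subseteq> M \<inter> closure (V i)" for i j
    proof (cases "i \<le> j")
      case True
      then show ?thesis
        using closure_mono[OF nhd_tower_antimono[OF V, of i j]] by blast
    next
      case False
      then show ?thesis
        using closure_mono[OF nhd_tower_antimono[OF V, of j i]] by auto
    qed
    show "(\<Inter>i. M \<inter> closure (V i)) \<subseteq> W"
      using W(2) nhd_tower_Inter_closure[OF V] by auto
  qed (use W in auto)
  then obtain i where i: "M \<inter> closure (V i) \<subseteq> W" by auto
  show thesis
  proof (rule that[of "W \<union> - closure (V i)" i])
    show "(W \<union> - closure (V i)) \<inter> V i \<subseteq> W"
      using closure_subset by blast
  qed (use W i in auto)
qed

section \<open>Left cosets converging to a compact subgroup\<close>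

text \<open>Convergence of the points \<open>C n\<close> to the base point \<open>M\<close> in the space of left cosets of the
  compact subgroup \<open>M\<close>, expressed without the quotient topology.\<close>

definition converging_cosets :: "'a::{group_add, topological_space} set \<Rightarrow> (nat \<Rightarrow> 'a set) \<Rightarrow> bool" where
  "converging_cosets M C \<longleftrightarrow> compact M \<and> add_subgroup M \<and> (\<forall>n. \<exists>c. C n = (+) c ` M) \<and>
     (\<forall>W. open W \<longrightarrow> M \<subseteq> W \<longrightarrow> (\<forall>\<^sub>F n in sequentially. C n \<subseteq> W))"

lemma converging_cosets_coset:
  assumes "converging_cosets M C" "a \<in> C n" shows "C n = (+) a ` M"
proof -
  obtain c where "C n = (+) c ` M"
    using assms(1) unfolding converging_cosets_def by blast
  moreover from this have "(+) a ` M = (+) c ` M"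
    using assms by (intro coset_eq) (simp_all add: converging_cosets_def)
  ultimately show ?thesis by simp
qed

lemma converging_cosets_compact: "converging_cosets M C \<Longrightarrow> compact M"
  and converging_cosets_subgroup: "converging_cosets M C \<Longrightarrow> add_subgroup M"
  by (simp_all add: converging_cosets_def)

lemma converging_cosets_rep:
  assumes "converging_cosets M C"
  obtains c where "c \<in> C n" "C n = (+) c ` M"
proof -
  obtain c where c: "C n = (+) c ` M"
    using assms unfolding converging_cosets_def by blast
  have "c \<in> (+) c ` M"
    by (rule coset_self[OF converging_cosets_subgroup[OF assms]])
  with c show thesis
    using that[of c] by blast
qed

text \<open>Points of the cosets can be made to converge to zero as far as one countable tower can
  tell: each \<open>V j\<close> is met by almost all \<open>C n\<close>, and a diagonal choice
  handles all \<open>j\<close> at once.\<close>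

lemma converging_cosets_selection:
  fixes M :: "'a::topological_group_add set"
  assumes MC: "converging_cosets M C" and V: "nhd_tower V"
  obtains y where "\<And>n. y n \<in> C n" "\<And>i. \<forall>\<^sub>F n in sequentially. y n \<in> V i"
proof -
  have meets: "\<forall>\<^sub>F n in sequentially. C n \<inter> V j \<noteq> {}" for j
  proof -
    \<comment> \<open>This is \<open>V j + M\<close>. Subtracting \<open>m\<close> on the right
      turns a point \<open>c\<close> of \<open>C n\<close> into \<open>c - m\<close>, which stays in
      the left coset \<open>c + M\<close> and lies in \<open>V j\<close>.\<close>
    define Q where "Q = (\<Union>m\<in>M. {z. z - m \<in> V j})"
    have "open Q"
      using V by (auto simp: Q_def nhd_tower_def intro!: open_vimage_diff_right)
    moreover have "M \<subseteq> Q"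
      using V by (auto simp: Q_def nhd_tower_def)
    ultimately have "\<forall>\<^sub>F n in sequentially. C n \<subseteq> Q"
      using MC unfolding converging_cosets_def by blast
    then show ?thesis
    proof eventually_elim
      case (elim n)
      obtain c where c: "c \<in> C n" "C n = (+) c ` M"
        by (rule converging_cosets_rep[OF MC])
      then obtain m where m: "m \<in> M" "c - m \<in> V j"
        using elim by (auto simp: Q_def)
      have "c + - m \<in> C n"
        unfolding c(2) using m(1) converging_cosets_subgroup[OF MC]
        by (intro imageI) (simp add: add_subgroup_def)
      with m(2) show ?case
        by (metis diff_conv_add_uminus disjoint_iff)
    qed
  qed
  \<comment> \<open>The point \<open>y n\<close> is taken in the smallest \<open>V j\<close> with
    \<open>j \<le> n\<close> that \<open>C n\<close> meets. The bound makes the maximum exist, and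
    any fixed \<open>i\<close> enters \<open>J n\<close> for almost all \<open>n\<close>.\<close>
  define J where "J n = {j. j \<le> n \<and> C n \<inter> V j \<noteq> {}}" for n
  have fin: "finite (J n)" for n
    by (rule finite_subset[of _ "{..n}"]) (auto simp: J_def)
  have "\<exists>y. y \<in> C n \<and> (J n \<noteq> {} \<longrightarrow> y \<in> V (Max (J n)))" for n
  proof (cases "J n = {}")
    case True
    have "C n \<noteq> {}"
      using converging_cosets_rep[OF MC, of n] by blast
    with True show ?thesis by auto
  next
    case False
    with Max_in[OF fin False] show ?thesis by (auto simp: J_def)
  qed
  then obtain y where y: "\<And>n. y n \<in> C n" "\<And>n. J n \<noteq> {} \<Longrightarrow> y n \<in> V (Max (J n))"
    by metis
  have "\<forall>\<^sub>F n in sequentially. y n \<in> V i" for i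
    using meets[of i] eventually_ge_at_top[of i]
  proof eventually_elim
    case (elim n)
    then have "i \<in> J n" by (simp add: J_def)
    then have "i \<le> Max (J n)" "J n \<noteq> {}"
      using fin by auto
    then show ?case
      using nhd_tower_antimono[OF V] y(2) by blast
  qed
  with y(1) show thesis
    using that by blast
qed

text \<open>The shrinking step for Zorn's lemma: a tower omitting \<open>v\<close> cuts
  \<open>M\<close> down to a proper compact subgroup, and the selected points \<open>y n\<close>
  represent the smaller cosets.\<close>

lemma converging_cosets_refine:
  fixes M :: "'a::{topological_group_add, t2_space} set"
  assumes MC: "converging_cosets M C" and v: "v \<in> M" "v \<noteq> 0"
  obtains M' C' where "converging_cosets M' C'" "M' \<subset> M" "\<And>n. C' n \<subseteq> C n"
proof -
  obtain V where V: "nhd_tower V" "V 0 \<subseteq> - {v}"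
    by (rule nhd_tower_exists[of "- {v}"]) (use v in auto)
  obtain y where y: "\<And>n. y n \<in> C n" "\<And>i. \<forall>\<^sub>F n in sequentially. y n \<in> V i"
    using converging_cosets_selection[OF MC V(1)] by blast
  define M' where "M' = M \<inter> (\<Inter>n. V n)"
  have sub: "(+) (y n) ` M' \<subseteq> C n" for n
    using converging_cosets_coset[OF MC y(1)] by (auto simp: M'_def)
  have "converging_cosets M' (\<lambda>n. (+) (y n) ` M')"
    unfolding converging_cosets_def
  proof (intro conjI allI impI)
    show "compact M'"
      unfolding M'_def using MC nhd_tower_closed_Inter[OF V(1)]
      by (auto simp: converging_cosets_def)
    show "add_subgroup M'"
      unfolding M'_def using MC nhd_tower_subgroup[OF V(1)]
      by (auto simp: converging_cosets_def intro: add_subgroup_Int)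
    fix W assume W: "open W" "M' \<subseteq> W"
    \<comment> \<open>Convergence of \<open>C\<close> to \<open>M\<close> takes care of
      \<open>Q\<close>, and the choice of \<open>y\<close> takes care of \<open>V i\<close>.\<close>
    obtain Q i where Q: "open Q" "M \<subseteq> Q" "Q \<inter> V i \<subseteq> W"
      by (rule nhd_tower_trap[OF V(1) _ W(1), of M])
        (use MC W in \<open>auto simp: converging_cosets_def M'_def\<close>)
    have "\<forall>\<^sub>F n in sequentially. C n \<subseteq> Q"
      using MC Q unfolding converging_cosets_def by blast
    \<comment> \<open>One index is spent on the sum: both \<open>y n\<close> and \<open>M'\<close>
      lie in \<open>V (Suc i)\<close>.\<close>
    with y(2)[of "Suc i"] show "\<forall>\<^sub>F n in sequentially. (+) (y n) ` M' \<subseteq> W"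
    proof eventually_elim
      case (elim n)
      then have "(+) (y n) ` M' \<subseteq> V i"
        using V(1) by (auto simp: M'_def nhd_tower_def)
      with elim sub[of n] Q(3) show ?case by blast
    qed
  qed auto
  moreover have "M' \<subset> M"
    using v V(2) by (auto simp: M'_def)
  ultimately show thesis
    using sub that by blast
qed

text \<open>Bounds for chains in Zorn's lemma. Compactness enters twice: the cosets with a given
  index have a common point, which represents them all, and an open set around the intersection of
  the subgroups already contains one of them.\<close>

lemma converging_cosets_Inter:
  fixes \<C> :: "('a::{topological_group_add, t2_space} set \<times> (nat \<Rightarrow> 'a set)) set"
  assumes "\<C> \<noteq> {}"
    and conv: "\<And>M C. (M, C) \<in> \<C> \<Longrightarrow> converging_cosets M C"
    and chain: "\<And>M C M' C'. (M, C) \<in> \<C> \<Longrightarrow> (M', C') \<in> \<C> \<Longrightarrow>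
      M \<subseteq> M' \<and> (\<forall>n. C n \<subseteq> C' n) \<or> M' \<subseteq> M \<and> (\<forall>n. C' n \<subseteq> C n)"
  shows "converging_cosets (\<Inter>p\<in>\<C>. fst p) (\<lambda>n. \<Inter>p\<in>\<C>. snd p n)"
  unfolding converging_cosets_def
proof (intro conjI allI impI)
  have conv': "converging_cosets (fst p) (snd p)" if "p \<in> \<C>" for p
    using conv that by (cases p) auto
  have chain': "fst p \<subseteq> fst q \<and> (\<forall>n. snd p n \<subseteq> snd q n) \<or> fst q \<subseteq> fst p \<and> (\<forall>n. snd q n \<subseteq> snd p n)"
    if "p \<in> \<C>" "q \<in> \<C>" for p q
    using chain[of "fst p" "snd p" "fst q" "snd q"] that by simp
  have cptM: "compact (fst p)" if "p \<in> \<C>" for p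
    by (rule converging_cosets_compact[OF conv'[OF that]])
  show "add_subgroup (\<Inter>p\<in>\<C>. fst p)"
    using conv' by (intro add_subgroup_Inter) (auto simp: converging_cosets_def)
  show "compact (\<Inter>p\<in>\<C>. fst p)"
  proof -
    obtain p where p: "p \<in> \<C>"
      using \<open>\<C> \<noteq> {}\<close> by blast
    have "compact (fst p \<inter> (\<Inter>p\<in>\<C>. fst p))"
      by (intro compact_Int_closed closed_INT ballI compact_imp_closed cptM p)
    with p show ?thesis
      by (simp add: inf.absorb2 INF_lower)
  qed
  fix n
  have cptC: "compact (snd p n)" and neC: "snd p n \<noteq> {}" if p: "p \<in> \<C>" for p
  proof -
    obtain c where "c \<in> snd p n" "snd p n = (+) c ` fst p"
      by (rule converging_cosets_rep[OF conv'[OF p]])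
    then show "compact (snd p n)" "snd p n \<noteq> {}"
      using compact_coset[OF cptM[OF p]] by auto
  qed
  \<comment> \<open>The chain lemma with the empty open set: an empty intersection would force an
    empty coset.\<close>
  have "\<not> (\<Inter>p\<in>\<C>. snd p n) \<subseteq> {}"
  proof
    assume "(\<Inter>p\<in>\<C>. snd p n) \<subseteq> {}"
    then have "\<exists>p\<in>\<C>. snd p n \<subseteq> {}"
      by (intro compact_chain_subset_open[OF \<open>\<C> \<noteq> {}\<close> cptC]) (use chain' in blast)+
    with neC show False by blast
  qed
  then obtain c where c: "\<And>p. p \<in> \<C> \<Longrightarrow> c \<in> snd p n" by blast
  have "(\<Inter>p\<in>\<C>. snd p n) = (\<Inter>p\<in>\<C>. (+) c ` fst p)"
    using converging_cosets_coset[OF conv' c] by (rule INF_cong[OF refl])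
  also have "\<dots> = (+) c ` (\<Inter>p\<in>\<C>. fst p)"
  proof -
    obtain q where q: "q \<in> \<C>"
      using \<open>\<C> \<noteq> {}\<close> by blast
    show ?thesis
      \<comment> \<open>Translation is injective, so it commutes with the intersection.\<close>
      by (subst image_INT[OF _ _ q, of "(+) c" UNIV]) auto
  qed
  finally show "\<exists>c. (\<Inter>p\<in>\<C>. snd p n) = (+) c ` (\<Inter>p\<in>\<C>. fst p)" by blast
next
  fix W :: "'a set" assume W: "open W" "(\<Inter>p\<in>\<C>. fst p) \<subseteq> W"
  have "\<exists>p\<in>\<C>. fst p \<subseteq> W"
  proof (rule compact_chain_subset_open[OF \<open>\<C> \<noteq> {}\<close> _ _ W])
    show "compact (fst p)" if "p \<in> \<C>" for p
      using conv[of "fst p" "snd p"] that by (simp add: converging_cosets_def)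
    show "fst p \<subseteq> fst q \<or> fst q \<subseteq> fst p" if "p \<in> \<C>" "q \<in> \<C>" for p q
      using chain[of "fst p" "snd p" "fst q" "snd q"] that by auto
  qed
  then obtain p where p: "p \<in> \<C>" "fst p \<subseteq> W" by blast
  have "\<forall>\<^sub>F n in sequentially. snd p n \<subseteq> W"
    using conv[of "fst p" "snd p"] p W(1) by (simp add: converging_cosets_def)
  then show "\<forall>\<^sub>F n in sequentially. (\<Inter>p\<in>\<C>. snd p n) \<subseteq> W"
    by eventually_elim (use p in blast)
qed

section \<open>Lifting to convergent points by minimality\<close>

text \<open>A minimal refinement of \<open>(M, C)\<close> has trivial subgroup, since any nonzero
  element would allow a further refinement. Its cosets are then single points, and their convergence
  to \<open>{0}\<close> is ordinary convergence.\<close>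

lemma converging_cosets_lift:
  fixes M :: "'a::{topological_group_add, t2_space} set"
  assumes MC: "converging_cosets M C"
  obtains y where "\<And>n. y n \<in> C n" "y \<longlonglongrightarrow> 0"
proof -
  define A where "A = {(M', C'). converging_cosets M' C' \<and> M' \<subseteq> M \<and> (\<forall>n. C' n \<subseteq> C n)}"
  \<comment> \<open>The order is reverse inclusion, so a maximal element is a minimal pair.\<close>
  define R :: "'a set \<times> (nat \<Rightarrow> 'a set) \<Rightarrow> 'a set \<times> (nat \<Rightarrow> 'a set) \<Rightarrow> bool"
    where "R p q \<longleftrightarrow> fst q \<subseteq> fst p \<and> (\<forall>n. snd q n \<subseteq> snd p n)" for p q
  have "\<exists>m\<in>A. \<forall>a\<in>A. R m a \<longrightarrow> a = m"
  proof (rule predicate_Zorn)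
    show "partial_order_on A (relation_of R A)"
      by (rule partial_order_on_relation_ofI) (auto simp: R_def prod_eq_iff fun_eq_iff, blast)
    fix \<C> assume "\<C> \<in> Chains (relation_of R A)"
    then have ch: "p \<in> A" "R p q \<or> R q p" if "p \<in> \<C>" "q \<in> \<C>" for p q
      using that by (auto simp: Chains_def relation_of_def)
    show "\<exists>u\<in>A. \<forall>a\<in>\<C>. R a u"
    proof (cases "\<C> = {}")
      case True
      then show ?thesis
        using MC by (auto simp: A_def)
    next
      case False
      then obtain p where p: "p \<in> \<C>" by blast
      have "converging_cosets (\<Inter>p\<in>\<C>. fst p) (\<lambda>n. \<Inter>p\<in>\<C>. snd p n)"
      proof (rule converging_cosets_Inter[OF False])
        show "converging_cosets M' C'" if "(M', C') \<in> \<C>" for M' C'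
          using ch(1)[OF that that] by (simp add: A_def)
        show "M1 \<subseteq> M2 \<and> (\<forall>n. C1 n \<subseteq> C2 n) \<or> M2 \<subseteq> M1 \<and> (\<forall>n. C2 n \<subseteq> C1 n)"
          if "(M1, C1) \<in> \<C>" "(M2, C2) \<in> \<C>" for M1 C1 M2 C2
          using ch(2)[OF that] by (auto simp: R_def)
      qed
      moreover have "fst p \<subseteq> M" "snd p n \<subseteq> C n" for n
        using ch(1)[OF p p] by (auto simp: A_def split_beta)
      then have "(\<Inter>p\<in>\<C>. fst p) \<subseteq> M" "(\<Inter>p\<in>\<C>. snd p n) \<subseteq> C n" for n
        using p by blast+
      ultimately have "((\<Inter>p\<in>\<C>. fst p), (\<lambda>n. \<Inter>p\<in>\<C>. snd p n)) \<in> A"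
        by (simp add: A_def)
      then show ?thesis
        by (rule bexI[rotated]) (auto simp: R_def)
    qed
  qed
  then obtain N D where "(N, D) \<in> A" and max: "\<And>a. a \<in> A \<Longrightarrow> R (N, D) a \<Longrightarrow> a = (N, D)"
    by (metis surj_pair)
  then have ND: "converging_cosets N D" "N \<subseteq> M" "D n \<subseteq> C n" for n
    by (auto simp: A_def)
  have "v = 0" if v: "v \<in> N" for v
  proof (rule ccontr)
    assume "v \<noteq> 0"
    then obtain M' C' where *: "converging_cosets M' C'" "M' \<subset> N" "\<And>n. C' n \<subseteq> D n"
      using converging_cosets_refine[OF ND(1) v] by blast
    then have "(M', C') \<in> A"
      using ND by (fastforce simp: A_def)
    then have "(M', C') = (N, D)"
      by (rule max) (use * in \<open>auto simp: R_def\<close>)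
    with * show False by auto
  qed
  then have N: "N = {0}"
    using ND(1) by (auto simp: converging_cosets_def add_subgroup_def)
  then have "\<forall>n. \<exists>c. D n = {c}"
    using ND(1) by (auto simp: converging_cosets_def)
  then obtain y where y: "\<And>n. D n = {y n}" by metis
  have "y \<longlonglongrightarrow> 0"
  proof (rule topological_tendstoI)
    fix S :: "'a set" assume "open S" "0 \<in> S"
    then have "\<forall>\<^sub>F n in sequentially. D n \<subseteq> S"
      using ND(1) N by (simp add: converging_cosets_def)
    then show "\<forall>\<^sub>F n in sequentially. y n \<in> S"
      by (simp add: y)
  qed
  then show thesis
    using that[of y] ND(3) y by auto
qed

section \<open>Sequences in feathered groups\<close>

text \<open>Left translation by \<open>- k\<close>, for a point \<open>k\<close> of the given
  compact set, is a homeomorphism and carries the set together with its countable base of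
  neighbourhoods.\<close>

lemma feathered_zero:
  assumes "feathered (euclidean :: 'a::{topological_group_add, t2_space} topology)"
  obtains K A where "compact K" "0 \<in> K" "\<And>n::nat. open (A n)" "\<And>n. K \<subseteq> A n"
    "\<And>W::'a set. open W \<Longrightarrow> K \<subseteq> W \<Longrightarrow> \<exists>n. A n \<subseteq> W"
proof -
  obtain K :: "'a set" where "K \<noteq> {}" and cpt: "compact K" and ch: "countable_character_in euclidean K"
    using assms by (auto simp: feathered_def)
  then obtain k where k: "k \<in> K" by blast
  obtain A where K: "\<And>n::nat. open (A n)" "\<And>n. K \<subseteq> A n"
    and base: "\<And>W::'a set. open W \<Longrightarrow> K \<subseteq> W \<Longrightarrow> \<exists>n. A n \<subseteq> W"
    using ch unfolding countable_character_in_def open_openin[symmetric] by metis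
  show thesis
  proof (rule that[of "(+) (- k) ` K" "\<lambda>n. {z. k + z \<in> A n}"])
    show "compact ((+) (- k) ` K)"
      using cpt by (rule compact_coset)
    show "0 \<in> (+) (- k) ` K"
      using k by (auto simp: image_iff intro!: bexI[of _ k])
    show "open {z. k + z \<in> A n}" for n
      using K(1) by (rule open_vimage_add_left)
    show "(+) (- k) ` K \<subseteq> {z. k + z \<in> A n}" for n
      using K(2)[of n] by (auto simp: add.assoc[symmetric])
    fix W :: "'a set" assume W: "open W" "(+) (- k) ` K \<subseteq> W"
    obtain n where n: "A n \<subseteq> {z. - k + z \<in> W}"
      using base[OF open_vimage_add_left[OF W(1)], of "- k"] W(2) by blast
    have "{z. k + z \<in> A n} \<subseteq> W"
    proof
      fix z assume "z \<in> {z. k + z \<in> A n}"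
      then have "- k + (k + z) \<in> W"
        using n by blast
      then show "z \<in> W"
        by (simp add: add.assoc[symmetric])
    qed
    then show "\<exists>n. {z. k + z \<in> A n} \<subseteq> W" by blast
  qed
qed

lemma feathered_sequence_to_zero:
  assumes "feathered (euclidean :: 'a::{topological_group_add, t2_space} topology)" and U: "open (U :: 'a set)" "0 \<in> closure U"
  obtains y where "\<And>n. y n \<in> U" "y \<longlonglongrightarrow> 0"
proof -
  obtain K A where K: "compact K" "0 \<in> K" "\<And>n::nat. open (A n)" "\<And>n. K \<subseteq> A n"
    and base: "\<And>W::'a set. open W \<Longrightarrow> K \<subseteq> W \<Longrightarrow> \<exists>n. A n \<subseteq> W"
    using feathered_zero[OF assms(1)] by blast
  \<comment> \<open>A pair holds the neighbourhood \<open>V n\<close> and the point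
    \<open>x n\<close>. \<open>P\<close> collects the conditions on one pair, \<open>Q\<close> those
    linking consecutive pairs.\<close>
  define P where "P n p \<longleftrightarrow> open (fst p) \<and> 0 \<in> fst p \<and> (\<forall>x\<in>fst p. - x \<in> fst p) \<and>
      fst p \<subseteq> A n \<and> snd p \<in> U \<inter> fst p" for n and p :: "'a set \<times> 'a"
  define Q where "Q p q \<longleftrightarrow> (\<forall>x\<in>fst q. \<forall>y\<in>fst q. x + y \<in> fst p) \<and> (\<forall>z\<in>fst q. snd p + z \<in> U)"
    for p q :: "'a set \<times> 'a"
  have nhd: "\<exists>p. P n p \<and> (\<forall>x\<in>fst p. \<forall>y\<in>fst p. x + y \<in> W) \<and> fst p \<subseteq> W"
    if W: "open W" "0 \<in> W" for W n
  proof -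
    have AW: "open (W \<inter> A n)" "0 \<in> W \<inter> A n"
      using W K by auto
    obtain V where V: "open V" "0 \<in> V" "V \<subseteq> W \<inter> A n" "\<And>x. x \<in> V \<Longrightarrow> - x \<in> V"
      "\<And>x y. x \<in> V \<Longrightarrow> y \<in> V \<Longrightarrow> x + y \<in> W \<inter> A n"
      using symmetric_nhd_halving[OF AW] by blast
    obtain x where "x \<in> U \<inter> V"
      using closure_meets_open[OF U(2) V(1,2)] by blast
    with V show ?thesis
      by (intro exI[of _ "(V, x)"]) (auto simp: P_def)
  qed
  have "\<exists>p. \<forall>n. P n (p n) \<and> Q (p n) (p (Suc n))"
  proof (rule dependent_nat_choice)
    show "\<exists>p. P 0 p"
      using nhd[of UNIV 0] by auto
    fix p n assume p: "P n p"
    \<comment> \<open>The next neighbourhood is halved inside this set, which contains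
      \<open>0\<close> because \<open>snd p\<close> lies in \<open>U\<close>.\<close>
    have "open (fst p \<inter> {z. snd p + z \<in> U})"
      using p U open_vimage_add_left by (auto simp: P_def)
    moreover have "0 \<in> fst p \<inter> {z. snd p + z \<in> U}"
      using p by (auto simp: P_def)
    ultimately show "\<exists>q. P (Suc n) q \<and> Q p q"
      using nhd[of "fst p \<inter> {z. snd p + z \<in> U}" "Suc n"] unfolding Q_def by blast
  qed
  then obtain p where p: "\<And>n. P n (p n)" "\<And>n. Q (p n) (p (Suc n))" by blast
  define V where "V n = fst (p n)" for n
  define x where "x n = snd (p n)" for n
  define H where "H = (\<Inter>n. V n)"
  have V: "nhd_tower V"
    using p by (auto simp: nhd_tower_def V_def P_def Q_def)
  have VA: "V n \<subseteq> A n" and x: "x n \<in> V n" and xU: "z \<in> V (Suc n) \<Longrightarrow> x n + z \<in> U" for n z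
    using p by (auto simp: V_def x_def P_def Q_def)
  \<comment> \<open>For \<open>h\<close> outside \<open>K\<close>, the complement of
    \<open>h\<close> contains some \<open>A n\<close> and hence \<open>V n\<close>.\<close>
  have HK: "H \<subseteq> K"
  proof
    fix h assume h: "h \<in> H"
    show "h \<in> K"
    proof (rule ccontr)
      assume "h \<notin> K"
      then obtain n where "A n \<subseteq> - {h}"
        using base[of "- {h}"] by auto
      with h VA show False by (auto simp: H_def)
    qed
  qed
  have "converging_cosets H (\<lambda>n. (+) (x n) ` H)"
    unfolding converging_cosets_def
  proof (intro conjI allI impI)
    have "compact (K \<inter> H)"
      unfolding H_def by (intro compact_Int_closed K nhd_tower_closed_Inter V)
    with HK show "compact H"
      by (simp add: inf.absorb2)
    show "add_subgroup H"
      unfolding H_def by (rule nhd_tower_subgroup[OF V])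
    fix W assume W: "open W" "H \<subseteq> W"
    \<comment> \<open>Since \<open>V k \<subseteq> A k \<subseteq> S\<close> for some
      \<open>k\<close>, the set \<open>V (max i k)\<close> lies in \<open>S \<inter> V i\<close> and
      so in \<open>W\<close>. Thus the tower is a neighbourhood base of \<open>H\<close>.\<close>
    obtain S i where S: "open S" "K \<subseteq> S" "S \<inter> V i \<subseteq> W"
      by (rule nhd_tower_trap[OF V K(1) W(1)]) (use W in \<open>auto simp: H_def\<close>)
    obtain k where k: "A k \<subseteq> S"
      using base S by blast
    have sub: "V (max i k) \<subseteq> W"
      using nhd_tower_antimono[OF V, of i "max i k"] nhd_tower_antimono[OF V, of k "max i k"] VA k S(3)
      by fastforce
    show "\<forall>\<^sub>F n in sequentially. (+) (x n) ` H \<subseteq> W"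
      using eventually_ge_at_top[of "Suc (max i k)"]
    proof eventually_elim
      case (elim n)
      then have "x n \<in> V (Suc (max i k))"
        using x nhd_tower_antimono[OF V] by blast
      then have "(+) (x n) ` H \<subseteq> V (max i k)"
        using V by (auto simp: nhd_tower_def H_def)
      with sub show ?case by blast
    qed
  qed auto
  then obtain y where y: "\<And>n. y n \<in> (+) (x n) ` H" "y \<longlonglongrightarrow> 0"
    using converging_cosets_lift by blast
  \<comment> \<open>The whole coset lies in \<open>U\<close>, because
    \<open>H \<subseteq> V (Suc n)\<close>.\<close>
  have "y n \<in> U" for n
    using y(1)[of n] xU by (auto simp: H_def)
  with y(2) show thesis
    using that by blast
qed

theorem theorem6p1:
  assumes "feathered (euclidean :: 'a :: {topological_group_add, t2_space} topology)"
  shows "kappa_Frechet_Urysohn (euclidean :: 'a topology)"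
  unfolding kappa_Frechet_Urysohn_def
proof (intro allI impI)
  fix U and x :: 'a
  assume "openin euclidean U \<and> x \<in> euclidean closure_of U"
  then have U: "open U" "x \<in> closure U"
    by auto
  \<comment> \<open>The set is \<open>U\<close> translated by \<open>- x\<close>; the sequence found
    in it is translated back by \<open>x\<close> at the end.\<close>
  have "0 \<in> closure {z. x + z \<in> U}"
    unfolding closure_iff_nhds_not_empty
  proof (intro allI impI)
    fix B V :: "'a set" assume V: "V \<subseteq> B" "open V" "0 \<in> V"
    have "open {z. - x + z \<in> V}" "x \<in> {z. - x + z \<in> V}"
      using V open_vimage_add_left by auto
    then obtain z where z: "z \<in> U" "- x + z \<in> V"
      using closure_meets_open[OF U(2)] by blast
    then have "- x + z \<in> {z. x + z \<in> U} \<inter> B"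
      using V(1) by (auto simp: add.assoc[symmetric])
    then show "{z. x + z \<in> U} \<inter> B \<noteq> {}" by blast
  qed
  then obtain y where y: "\<And>n. y n \<in> {z. x + z \<in> U}" "y \<longlonglongrightarrow> 0"
    using feathered_sequence_to_zero[OF assms open_vimage_add_left[OF U(1)]] by blast
  have "(\<lambda>n. x + y n) \<longlonglongrightarrow> x + 0"
    by (intro tendsto_intros y)
  with y(1) show "\<exists>s::nat \<Rightarrow> 'a. range s \<subseteq> U \<and> limitin euclidean s x sequentially"
    by (intro exI[of _ "\<lambda>n. x + y n"]) auto
qed

end
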